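(* Let $M$ be a finitely generated commutative binoid and let $\mathscr{F}$ be a sheaf of abelian groups on $\operatorname{Spec} M$. Then $\mathrm{H}^i(\operatorname{Spec} M,\mathscr{F})=0$ for every $i\geq 1$.
   Context: A (commutative) binoid is a commutative monoid $(M,+,0)$ together with an absorbing element $\infty$ ($a+\infty=\infty$ for all $a\in M$). An ideal of $M$ is a subset $I\ni\infty$ with $I+M\subseteq I$. A prime ideal is an ideal $\mathfrak p$ such that $M\smallsetminus\mathfrak p$ is a submonoid of $M$. $\operatorname{Spec} M$ is the set of prime ideals of $M$ with the Zariski topology, which has as a basis the sets $D(f)=\{\mathfrak p\in\operatorname{Spec}M\mid f\notin\mathfrak p\}$, $f\in M$. $\mathrm{H}^i$ denotes sheaf cohomology on the topological space $\operatorname{Spec}M$. *)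

theory Defs
  imports "HOL-Analysis.Abstract_Topology" "HOL-Algebra.Elementary_Groups"
begin

section \<open>Commutative binoids and their spectra\<close>

text \<open>As usual in HOL-Algebra the monoid operation is written multiplicatively: the sum
  \<open>a + b\<close> of the binoid is \<open>a \<otimes> b\<close> and its neutral element \<open>0\<close> is \<open>\<one>\<close>.
  The zero binoid, in which \<open>\<one> = \<infinity>\<close>, is allowed; its spectrum is empty.\<close>

record 'm binoid = "'m monoid" +
  infty :: 'm (\<open>\<infinity>\<index>\<close>)

locale comm_binoid = comm_monoid M for M :: "('m, 'z) binoid_scheme" (structure) +
  assumes infty_closed [simp]: "\<infinity> \<in> carrier M"
    and infty_absorb: "a \<in> carrier M \<Longrightarrow> a \<otimes> \<infinity> = \<infinity>"

text \<open>Generation as a binoid: \<open>\<one>\<close> and \<open>\<infinity>\<close> belong to every subbinoid.\<close>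

definition fin_gen_binoid :: "('m, 'z) binoid_scheme \<Rightarrow> bool" where
  "fin_gen_binoid M \<longleftrightarrow>
    (\<exists>A. finite A \<and> A \<subseteq> carrier M \<and>
      (\<forall>H. submonoid H M \<and> \<infinity>\<^bsub>M\<^esub> \<in> H \<and> A \<subseteq> H \<longrightarrow> H = carrier M))"

definition binoid_ideal :: "('m, 'z) binoid_scheme \<Rightarrow> 'm set \<Rightarrow> bool" where
  "binoid_ideal M I \<longleftrightarrow>
    I \<subseteq> carrier M \<and> \<infinity>\<^bsub>M\<^esub> \<in> I \<and> (\<forall>a\<in>I. \<forall>b\<in>carrier M. a \<otimes>\<^bsub>M\<^esub> b \<in> I)"

definition binoid_prime :: "('m, 'z) binoid_scheme \<Rightarrow> 'm set \<Rightarrow> bool" where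
  "binoid_prime M p \<longleftrightarrow> binoid_ideal M p \<and> submonoid (carrier M - p) M"

definition Spec :: "('m, 'z) binoid_scheme \<Rightarrow> 'm set set" where
  "Spec M = {p. binoid_prime M p}"

definition basic_open :: "('m, 'z) binoid_scheme \<Rightarrow> 'm \<Rightarrow> 'm set set" where
  "basic_open M f = {p \<in> Spec M. f \<notin> p}"

definition Zariski :: "('m, 'z) binoid_scheme \<Rightarrow> 'm set topology" where
  "Zariski M = topology (arbitrary union_of (\<lambda>U. U \<in> basic_open M ` carrier M))"

lemma (in comm_binoid) basic_open_mult:
  assumes f: "f \<in> carrier M" and g: "g \<in> carrier M"
  shows "basic_open M f \<inter> basic_open M g = basic_open M (f \<otimes> g)"
proof (rule equalityI; rule subsetI)
  fix p assume "p \<in> basic_open M f \<inter> basic_open M g"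
  then have p: "p \<in> Spec M" "f \<in> carrier M - p" "g \<in> carrier M - p"
    using f g by (auto simp: basic_open_def)
  then have "submonoid (carrier M - p) M" by (simp add: Spec_def binoid_prime_def)
  from submonoid.m_closed[OF this p(2,3)] show "p \<in> basic_open M (f \<otimes> g)"
    using p(1) by (simp add: basic_open_def)
next
  fix p assume p: "p \<in> basic_open M (f \<otimes> g)"
  then have "binoid_ideal M p" by (simp add: basic_open_def Spec_def binoid_prime_def)
  then have "f \<in> p \<Longrightarrow> f \<otimes> g \<in> p" "g \<in> p \<Longrightarrow> g \<otimes> f \<in> p"
    using f g by (auto simp: binoid_ideal_def)
  then show "p \<in> basic_open M f \<inter> basic_open M g"
    using p m_comm[OF f g] by (auto simp: basic_open_def)
qed

text \<open>The sets \<open>D(f)\<close> do form the basis of a topology, so that \<^const>\<open>topology\<close> yields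
  the intended open sets.\<close>

lemma (in comm_binoid) openin_Zariski:
  "openin (Zariski M) = arbitrary union_of (\<lambda>U. U \<in> basic_open M ` carrier M)"
  unfolding Zariski_def
  by (rule topology_inverse', rule istopology_base) (auto simp: basic_open_mult)

lemma (in comm_binoid) topspace_Zariski: "topspace (Zariski M) = Spec M"
proof
  show "topspace (Zariski M) \<subseteq> Spec M"
    by (auto simp: topspace_def openin_Zariski union_of_def basic_open_def)
  have "basic_open M \<one> = Spec M"
    by (auto simp: basic_open_def Spec_def binoid_prime_def dest: submonoid.one_closed)
  then have "openin (Zariski M) (Spec M)"
    unfolding openin_Zariski by (intro arbitrary_union_of_inc) (metis imageI one_closed)
  then show "Spec M \<subseteq> topspace (Zariski M)" by (rule openin_subset)
qed


section \<open>Sheaves of abelian groups on a topological space\<close>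

text \<open>\<open>restr F U V\<close> is the restriction map from \<open>sections F U\<close> to \<open>sections F V\<close>,
  for \<open>V \<subseteq> U\<close>; the values on sets that are not open are irrelevant.\<close>

record ('p, 'a) presheaf_data =
  sections :: "'p set \<Rightarrow> 'a monoid"
  restr :: "'p set \<Rightarrow> 'p set \<Rightarrow> 'a \<Rightarrow> 'a"

locale ab_presheaf =
  fixes X :: "'p topology" and F :: "('p, 'a) presheaf_data"
  assumes ab_group: "openin X U \<Longrightarrow> comm_group (sections F U)"
    and restr_hom: "\<lbrakk>openin X U; openin X V; V \<subseteq> U\<rbrakk>
      \<Longrightarrow> restr F U V \<in> hom (sections F U) (sections F V)"
    and restr_id: "\<lbrakk>openin X U; s \<in> carrier (sections F U)\<rbrakk> \<Longrightarrow> restr F U U s = s"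
    and restr_comp: "\<lbrakk>openin X U; openin X V; openin X W; W \<subseteq> V; V \<subseteq> U;
        s \<in> carrier (sections F U)\<rbrakk> \<Longrightarrow> restr F V W (restr F U V s) = restr F U W s"

text \<open>The empty covering of the empty set is included, hence \<open>sections F {}\<close> is trivial.\<close>

locale ab_sheaf = ab_presheaf +
  assumes locality: "\<lbrakk>\<And>V. V \<in> \<U> \<Longrightarrow> openin X V;
        s \<in> carrier (sections F (\<Union>\<U>)); t \<in> carrier (sections F (\<Union>\<U>));
        \<And>V. V \<in> \<U> \<Longrightarrow> restr F (\<Union>\<U>) V s = restr F (\<Union>\<U>) V t\<rbrakk> \<Longrightarrow> s = t"
    and gluing: "\<lbrakk>\<And>V. V \<in> \<U> \<Longrightarrow> openin X V;
        \<And>V. V \<in> \<U> \<Longrightarrow> \<sigma> V \<in> carrier (sections F V);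
        \<And>V W. \<lbrakk>V \<in> \<U>; W \<in> \<U>\<rbrakk> \<Longrightarrow> restr F V (V \<inter> W) (\<sigma> V) = restr F W (V \<inter> W) (\<sigma> W)\<rbrakk>
      \<Longrightarrow> \<exists>s\<in>carrier (sections F (\<Union>\<U>)). \<forall>V\<in>\<U>. restr F (\<Union>\<U>) V s = \<sigma> V"

definition sheaf_mor ::
  "'p topology \<Rightarrow> ('p, 'a) presheaf_data \<Rightarrow> ('p, 'b) presheaf_data \<Rightarrow> ('p set \<Rightarrow> 'a \<Rightarrow> 'b) \<Rightarrow> bool"
where
  "sheaf_mor X F G \<phi> \<longleftrightarrow>
    (\<forall>U. openin X U \<longrightarrow> \<phi> U \<in> hom (sections F U) (sections G U)) \<and>
    (\<forall>U V. openin X U \<and> openin X V \<and> V \<subseteq> U \<longrightarrow>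
      (\<forall>s\<in>carrier (sections F U). \<phi> V (restr F U V s) = restr G U V (\<phi> U s)))"

definition sheaf_ker ::
  "('p, 'a) presheaf_data \<Rightarrow> ('p, 'b) presheaf_data \<Rightarrow> ('p set \<Rightarrow> 'a \<Rightarrow> 'b) \<Rightarrow> 'p set \<Rightarrow> 'a set"
where
  "sheaf_ker F G \<phi> U = kernel (sections F U) (sections G U) (\<phi> U)"

text \<open>The image sheaf, realised inside the target: its sections are those that locally lie in the
  image of \<open>\<phi>\<close> (this is the sheafification of the image presheaf).\<close>

definition sheaf_im ::
  "'p topology \<Rightarrow> ('p, 'a) presheaf_data \<Rightarrow> ('p, 'b) presheaf_data \<Rightarrow> ('p set \<Rightarrow> 'a \<Rightarrow> 'b)
    \<Rightarrow> 'p set \<Rightarrow> 'b set"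
where
  "sheaf_im X F G \<phi> U =
    {t \<in> carrier (sections G U).
      \<forall>x\<in>U. \<exists>V. openin X V \<and> x \<in> V \<and> V \<subseteq> U \<and> restr G U V t \<in> \<phi> V ` carrier (sections F V)}"

definition sheaf_mono ::
  "'p topology \<Rightarrow> ('p, 'a) presheaf_data \<Rightarrow> ('p, 'b) presheaf_data \<Rightarrow> ('p set \<Rightarrow> 'a \<Rightarrow> 'b) \<Rightarrow> bool"
where
  "sheaf_mono X F G \<phi> \<longleftrightarrow>
    sheaf_mor X F G \<phi> \<and> (\<forall>U. openin X U \<longrightarrow> sheaf_ker F G \<phi> U = {\<one>\<^bsub>sections F U\<^esub>})"

definition sheaf_exact ::
  "'p topology \<Rightarrow> ('p, 'a) presheaf_data \<Rightarrow> ('p, 'b) presheaf_data \<Rightarrow> ('p, 'c) presheaf_data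
    \<Rightarrow> ('p set \<Rightarrow> 'a \<Rightarrow> 'b) \<Rightarrow> ('p set \<Rightarrow> 'b \<Rightarrow> 'c) \<Rightarrow> bool"
where
  "sheaf_exact X F G H \<phi> \<psi> \<longleftrightarrow>
    sheaf_mor X F G \<phi> \<and> sheaf_mor X G H \<psi> \<and>
    (\<forall>U. openin X U \<longrightarrow> sheaf_im X F G \<phi> U = sheaf_ker G H \<psi> U)"


section \<open>Sheaf cohomology\<close>

text \<open>The category of sheaves is the one of sheaves whose sections are elements of a type \<open>'c\<close>,
  which plays the role of a universe. For a space with points of type \<open>'p\<close> and sheaves with
  sections of type \<open>'a\<close>, the universe \<open>'c = ('p \<times> nat \<Rightarrow> 'a + nat)\<close> is large enough for
  this category to have enough injectives, and for injectivity relative to \<open>'c\<close> to be injectivity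
  with respect to all sheaves (it suffices to test subsheaves of the extensions by zero of the
  constant sheaf with value the integers on open sets).\<close>

definition injective_sheaf :: "'p topology \<Rightarrow> ('p, 'c) presheaf_data \<Rightarrow> bool" where
  "injective_sheaf X J \<longleftrightarrow> ab_sheaf X J \<and>
    (\<forall>(A :: ('p, 'c) presheaf_data) (B :: ('p, 'c) presheaf_data) \<iota> \<phi>.
      ab_sheaf X A \<and> ab_sheaf X B \<and> sheaf_mono X A B \<iota> \<and> sheaf_mor X A J \<phi> \<longrightarrow>
      (\<exists>\<psi>. sheaf_mor X B J \<psi> \<and>
        (\<forall>U. openin X U \<longrightarrow> (\<forall>s\<in>carrier (sections A U). \<psi> U (\<iota> U s) = \<phi> U s))))"

text \<open>An exact sequence \<open>0 \<rightarrow> F \<rightarrow> J 0 \<rightarrow> J 1 \<rightarrow> \<dots>\<close> with all \<open>J n\<close> injective;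
  the augmentation is \<open>\<epsilon>\<close> and the differentials are \<open>d n\<close>, from \<open>J n\<close> to \<open>J (Suc n)\<close>.\<close>

definition injective_resolution ::
  "'p topology \<Rightarrow> ('p, 'a) presheaf_data \<Rightarrow> ('p set \<Rightarrow> 'a \<Rightarrow> 'c)
    \<Rightarrow> (nat \<Rightarrow> ('p, 'c) presheaf_data) \<Rightarrow> (nat \<Rightarrow> 'p set \<Rightarrow> 'c \<Rightarrow> 'c) \<Rightarrow> bool"
where
  "injective_resolution X F \<epsilon> J d \<longleftrightarrow>
    (\<forall>n. injective_sheaf X (J n)) \<and>
    sheaf_mono X F (J 0) \<epsilon> \<and>
    sheaf_exact X F (J 0) (J 1) \<epsilon> (d 0) \<and>
    (\<forall>n. sheaf_exact X (J n) (J (Suc n)) (J (Suc (Suc n))) (d n) (d (Suc n)))"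

text \<open>The \<open>i\<close>-th cohomology group of the complex of global sections of \<open>(J, d)\<close>. If \<open>(J, d)\<close> is
  an injective resolution of \<open>F\<close>, then this is, by definition of the right derived functors of the
  global sections functor, the group \<open>H\<^sup>i(X, F)\<close>; different resolutions give canonically
  isomorphic groups.\<close>

definition global_cocycles ::
  "'p topology \<Rightarrow> (nat \<Rightarrow> ('p, 'c) presheaf_data) \<Rightarrow> (nat \<Rightarrow> 'p set \<Rightarrow> 'c \<Rightarrow> 'c) \<Rightarrow> nat \<Rightarrow> 'c monoid"
where
  "global_cocycles X J d i =
    (sections (J i) (topspace X))
      \<lparr>carrier := kernel (sections (J i) (topspace X)) (sections (J (Suc i)) (topspace X))
        (d i (topspace X))\<rparr>"

definition global_coboundaries ::
  "'p topology \<Rightarrow> (nat \<Rightarrow> ('p, 'c) presheaf_data) \<Rightarrow> (nat \<Rightarrow> 'p set \<Rightarrow> 'c \<Rightarrow> 'c) \<Rightarrow> nat \<Rightarrow> 'c set"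
where
  "global_coboundaries X J d i =
    (case i of
      0 \<Rightarrow> {\<one>\<^bsub>sections (J 0) (topspace X)\<^esub>}
    | Suc k \<Rightarrow> d k (topspace X) ` carrier (sections (J k) (topspace X)))"

definition global_cohomology ::
  "'p topology \<Rightarrow> (nat \<Rightarrow> ('p, 'c) presheaf_data) \<Rightarrow> (nat \<Rightarrow> 'p set \<Rightarrow> 'c \<Rightarrow> 'c) \<Rightarrow> nat
    \<Rightarrow> 'c set monoid"
where
  "global_cohomology X J d i = global_cocycles X J d i Mod global_coboundaries X J d i"

end

theory Submission
  imports Defs
begin

text \<open>If \<open>\<one> = \<infinity>\<close>, then the spectrum is empty. Otherwise the non-units form the largest prime
  ideal of \<open>M\<close>, and \<open>D(f)\<close> contains it only if \<open>f\<close> is a unit, that is, only if \<open>D(f) = Spec M\<close>.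
  So this point has no open neighbourhood but the whole space: a section that locally
  lifts along a sheaf morphism lifts globally, and the global sections functor is exact.\<close>

lemma (in comm_binoid) unit_notin_prime:
  assumes "p \<in> Spec M" "f \<in> Units M"
  shows "f \<notin> p"
proof
  assume "f \<in> p"
  moreover have "binoid_ideal M p" "\<one> \<in> carrier M - p"
    using assms(1) by (auto simp: Spec_def binoid_prime_def dest: submonoid.one_closed)
  ultimately have "f \<otimes> inv f \<in> p"
    using Units_inv_closed[OF assms(2)] unfolding binoid_ideal_def by blast
  then show False
    using assms(2) \<open>\<one> \<in> carrier M - p\<close> by simp
qed

text \<open>Every ideal contains \<open>\<infinity>\<close>, while a prime contains no unit. The
  hypothesis amounts to \<open>\<one> = \<infinity>\<close>, because absorption makes the product of
  \<open>\<infinity>\<close> with its inverse equal to \<open>\<infinity>\<close>.\<close>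

lemma (in comm_binoid) Spec_empty:
  assumes "\<infinity> \<in> Units M"
  shows "Spec M = {}"
  using unit_notin_prime[OF _ assms]
  by (auto simp: Spec_def binoid_prime_def binoid_ideal_def)

text \<open>The complement is the group of units, hence a submonoid. The ideal property holds
  because, by commutativity, every factor of a unit is a unit.\<close>

lemma (in comm_binoid) nonunits_in_Spec:
  assumes "\<infinity> \<notin> Units M"
  shows "carrier M - Units M \<in> Spec M"
proof -
  have "carrier M - (carrier M - Units M) = Units M" by auto
  moreover have "submonoid (Units M) M"
    by unfold_locales auto
  moreover have "a \<otimes> b \<notin> Units M" if "a \<in> carrier M" "a \<notin> Units M" "b \<in> carrier M" for a b
  proof
    assume u: "a \<otimes> b \<in> Units M"
    \<comment> \<open>The inverse of the product, multiplied by \<open>b\<close>, is an inverse of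
      \<open>a\<close>.\<close>
    then have "a \<otimes> (b \<otimes> inv (a \<otimes> b)) = \<one>"
      using that u by (simp flip: m_assoc)
    then show False
      using that Units_inv_closed[OF u] m_comm[of a "b \<otimes> inv (a \<otimes> b)"] by (auto simp: Units_def)
  qed
  ultimately show ?thesis
    using assms by (auto simp: Spec_def binoid_prime_def binoid_ideal_def)
qed

lemma (in comm_binoid) open_nonunits_imp_Spec:
  assumes V: "openin (Zariski M) V" and "carrier M - Units M \<in> V"
  shows "V = Spec M"
proof -
  obtain f where f: "f \<in> carrier M" "carrier M - Units M \<in> basic_open M f" "basic_open M f \<subseteq> V"
    using assms unfolding openin_Zariski union_of_def by blast
  then have "f \<in> Units M" by (auto simp: basic_open_def)
  then have "basic_open M f = Spec M"
    using unit_notin_prime by (auto simp: basic_open_def)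
  then show ?thesis
    using f(3) openin_subset[OF V] topspace_Zariski by auto
qed

text \<open>For the empty covering of the empty set, the agreement required by locality is
  vacuous.\<close>

lemma (in ab_sheaf) sections_empty:
  assumes "s \<in> carrier (sections F {})" "t \<in> carrier (sections F {})"
  shows "s = t"
  using locality[of "{}" s t] assms by simp

text \<open>This is the passage from exactness of sheaves to exactness of global sections: the left
  side comes from sheaf exactness, the right side is the group of coboundaries.\<close>

lemma sheaf_im_topspace:
  assumes G: "ab_sheaf X G" and F: "ab_sheaf X F" and mor: "sheaf_mor X F G \<phi>"
    and local: "topspace X = {} \<or> (\<exists>x\<in>topspace X. \<forall>V. openin X V \<and> x \<in> V \<longrightarrow> V = topspace X)"
  shows "sheaf_im X F G \<phi> (topspace X) = \<phi> (topspace X) ` carrier (sections F (topspace X))"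
    (is "?L = ?R")
proof
  interpret G: ab_sheaf X G by fact
  interpret F: ab_sheaf X F by fact
  let ?U = "topspace X"
  interpret FU: comm_group "sections F ?U" by (rule F.ab_group) simp
  have hom: "\<phi> ?U \<in> hom (sections F ?U) (sections G ?U)"
    using mor by (simp add: sheaf_mor_def)
  show "?R \<subseteq> ?L"
  proof
    fix t assume t: "t \<in> ?R"
    then have c: "t \<in> carrier (sections G ?U)"
      using hom_in_carrier[OF hom] by blast
    \<comment> \<open>The whole space serves as the neighbourhood of every point.\<close>
    moreover have "restr G ?U ?U t = t"
      by (rule G.restr_id[OF openin_topspace c])
    ultimately show "t \<in> ?L"
      unfolding sheaf_im_def mem_Collect_eq using t by (metis openin_topspace order_refl)
  qed
  show "?L \<subseteq> ?R"
  proof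
    fix t assume t: "t \<in> ?L"
    then have c: "t \<in> carrier (sections G ?U)" by (simp add: sheaf_im_def)
    from local show "t \<in> ?R"
    proof
      assume e: "?U = {}"
      \<comment> \<open>Membership in \<open>?L\<close> gives no lift here, as there are no points;
        but \<open>t\<close> is the only section over the empty set, so the neutral element maps to
        it.\<close>
      have "\<phi> ?U \<one>\<^bsub>sections F ?U\<^esub> = t"
        using G.sections_empty hom_in_carrier[OF hom FU.one_closed] c unfolding e by blast
      then show ?thesis by blast
    next
      assume "\<exists>x\<in>?U. \<forall>V. openin X V \<and> x \<in> V \<longrightarrow> V = ?U"
      \<comment> \<open>The neighbourhood of \<open>x\<close> on which \<open>t\<close> lifts can
        only be \<open>?U\<close>.\<close>
      then have "restr G ?U ?U t \<in> ?R"
        using t unfolding sheaf_im_def by blast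
      then show ?thesis
        using G.restr_id[OF openin_topspace c] by simp
    qed
  qed
qed

lemma (in group) trivial_group_Mod_self:
  assumes "subgroup K G"
  shows "trivial_group (G\<lparr>carrier := K\<rparr> Mod K)"
proof -
  interpret K: group "G\<lparr>carrier := K\<rparr>"
    by (rule subgroup.subgroup_is_group[OF assms is_group])
  have N: "K \<lhd> G\<lparr>carrier := K\<rparr>"
    using K.normal_self by simp
  have "K #>\<^bsub>G\<lparr>carrier := K\<rparr>\<^esub> a = K" if "a \<in> K" for a
    using K.coset_join2[of a K] that K.subgroup_self by simp
  then have "rcosets\<^bsub>G\<lparr>carrier := K\<rparr>\<^esub> K = {K}"
    using subgroup.one_closed[OF assms] by (auto simp: RCOSETS_def)
  then show ?thesis
    using normal.factorgroup_is_group[OF N] by (simp add: trivial_group_def FactGroup_def)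
qed

theorem theorem1p67:
  fixes M :: "('m, 'z) binoid_scheme"
    and F :: "('m set, 'a) presheaf_data"
    and \<epsilon> :: "'m set set \<Rightarrow> 'a \<Rightarrow> 'c"
    and J :: "nat \<Rightarrow> ('m set, 'c) presheaf_data"
    and d :: "nat \<Rightarrow> 'm set set \<Rightarrow> 'c \<Rightarrow> 'c"
    and i :: nat
  assumes "comm_binoid M"
    and "fin_gen_binoid M"
    and "ab_sheaf (Zariski M) F"
    and "injective_resolution (Zariski M) F \<epsilon> J d"
    and "i \<ge> 1"
  shows "trivial_group (global_cohomology (Zariski M) J d i)"
proof -
  interpret comm_binoid M by fact
  let ?X = "Zariski M"
  let ?U = "topspace ?X"
  \<comment> \<open>In positive degree the coboundaries are the image of \<open>d k\<close>, not the
    trivial subgroup.\<close>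
  obtain k where i: "i = Suc k"
    using \<open>i \<ge> 1\<close> by (cases i) auto
  have sh: "ab_sheaf ?X (J n)" for n
    using assms(4) by (simp add: injective_resolution_def injective_sheaf_def)
  have ex: "sheaf_exact ?X (J k) (J i) (J (Suc i)) (d k) (d i)"
    using assms(4) by (simp add: injective_resolution_def i)
  have "?U = {} \<or> (\<exists>x\<in>?U. \<forall>V. openin ?X V \<and> x \<in> V \<longrightarrow> V = ?U)"
    using Spec_empty nonunits_in_Spec open_nonunits_imp_Spec
    unfolding topspace_Zariski by blast
  \<comment> \<open>Exactness at \<open>J i\<close>, read on global sections: every cocycle is a
    coboundary, so the cohomology is a group modulo itself.\<close>
  then have im: "d k ?U ` carrier (sections (J k) ?U) =
      kernel (sections (J i) ?U) (sections (J (Suc i)) ?U) (d i ?U)"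
    using sheaf_im_topspace[OF sh sh, of k i "d k"] ex
    by (simp add: sheaf_exact_def sheaf_ker_def)
  have gr: "group (sections (J n) ?U)" for n
    using ab_presheaf.ab_group[OF ab_sheaf.axioms(1)[OF sh] openin_topspace]
    by (rule comm_group.axioms(2))
  have "d i ?U \<in> hom (sections (J i) ?U) (sections (J (Suc i)) ?U)"
    using ex by (simp add: sheaf_exact_def sheaf_mor_def)
  then have "group_hom (sections (J i) ?U) (sections (J (Suc i)) ?U) (d i ?U)"
    using gr by (simp add: group_hom_def group_hom_axioms_def)
  then have "subgroup (kernel (sections (J i) ?U) (sections (J (Suc i)) ?U) (d i ?U))
      (sections (J i) ?U)"
    by (rule group_hom.subgroup_kernel)
  then show ?thesis
    using group.trivial_group_Mod_self[OF gr] im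
    by (simp add: global_cohomology_def global_cocycles_def global_coboundaries_def i)
qed

end
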